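(* Let $m\geq0$ and $n\geq1$ be integers and let $(a_{ij})_{1\leq i,j\leq 2(n+m)}$ be (the height array of) an element of $\mathcal{S}_{n,m}$. Associate to it the triangular array $\big(a_{i+1,j+1}-(n+2m)\big)_{1\leq i\leq j\leq n+m-1}$. Then this triangular array belongs to $\mathcal{T}_{n,m}$, and this map $\mathcal{S}_{n,m}\to\mathcal{T}_{n,m}$ is a bijection.
   Context: A plane partition is identified with its Ferrers graph, a finite set $\pi\subset\mathbb{P}^3$ ($\mathbb{P}$ the positive integers) such that $(x_2,y_2,z_2)\in\pi$ and $x_1\le x_2,y_1\le y_2,z_1\le z_2$ imply $(x_1,y_1,z_1)\in\pi$; its height array is $a_{ij}=\#\{z:(i,j,z)\in\pi\}$. Let $M=n+m$. A totally symmetric self-complementary plane partition of size $M$ is a plane partition $\pi\subseteq[2M]^3$ invariant under all permutations of the coordinates and such that for every $(x,y,z)\in[2M]^3$, $(x,y,z)\in\pi$ iff $(2M+1-x,2M+1-y,2M+1-z)\notin\pi$. $\mathcal{S}_{n,m}$ is the set of such $\pi$ satisfying: every $(x,y,z)\in\pi$ with $n+1\leq x,y,z\leq n+2m$ has at least two of its coordinates $\leq n+m$. $\mathcal{T}_{n,m}$ is the set of arrays $b=(b_{ij})_{1\leq i\leq j\leq n+m-1}$ of integers, weakly decreasing along rows and columns ($b_{ij}\ge b_{i,j+1}$, $b_{ij}\ge b_{i+1,j}$ whenever defined), with $\max\{n-i,0\}\leq b_{ij}\leq n$. *)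

theory Defs
  imports Complex_Main "HOL-Library.FuncSet"
begin

(* The positive integers are the positive elements of nat. *)
definition plane_partition :: "(nat \<times> nat \<times> nat) set \<Rightarrow> bool" where
  "plane_partition \<pi> \<longleftrightarrow>
     finite \<pi> \<and>
     (\<forall>(x, y, z) \<in> \<pi>. 1 \<le> x \<and> 1 \<le> y \<and> 1 \<le> z) \<and>
     (\<forall>x1 y1 z1 x2 y2 z2.
        (x2, y2, z2) \<in> \<pi> \<and> 1 \<le> x1 \<and> x1 \<le> x2 \<and> 1 \<le> y1 \<and> y1 \<le> y2 \<and> 1 \<le> z1 \<and> z1 \<le> z2
        \<longrightarrow> (x1, y1, z1) \<in> \<pi>)"

definition height :: "(nat \<times> nat \<times> nat) set \<Rightarrow> nat \<Rightarrow> nat \<Rightarrow> nat" where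
  "height \<pi> i j = card {z. (i, j, z) \<in> \<pi>}"

definition totally_symmetric :: "(nat \<times> nat \<times> nat) set \<Rightarrow> bool" where
  "totally_symmetric \<pi> \<longleftrightarrow>
     (\<forall>x y z. (x, y, z) \<in> \<pi> \<longrightarrow>
        (x, z, y) \<in> \<pi> \<and> (y, x, z) \<in> \<pi> \<and> (y, z, x) \<in> \<pi> \<and> (z, x, y) \<in> \<pi> \<and> (z, y, x) \<in> \<pi>)"

(* The subtractions below do not truncate, since the coordinates are at most 2 * M. *)
definition self_complementary :: "nat \<Rightarrow> (nat \<times> nat \<times> nat) set \<Rightarrow> bool" where
  "self_complementary M \<pi> \<longleftrightarrow>
     (\<forall>x \<in> {1..2 * M}. \<forall>y \<in> {1..2 * M}. \<forall>z \<in> {1..2 * M}.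
        (x, y, z) \<in> \<pi> \<longleftrightarrow> (2 * M + 1 - x, 2 * M + 1 - y, 2 * M + 1 - z) \<notin> \<pi>)"

definition TSSCPP :: "nat \<Rightarrow> (nat \<times> nat \<times> nat) set set" where
  "TSSCPP M = {\<pi>. plane_partition \<pi> \<and> \<pi> \<subseteq> {1..2 * M} \<times> {1..2 * M} \<times> {1..2 * M} \<and>
                   totally_symmetric \<pi> \<and> self_complementary M \<pi>}"

definition S_set :: "nat \<Rightarrow> nat \<Rightarrow> (nat \<times> nat \<times> nat) set set" where
  "S_set n m = {\<pi> \<in> TSSCPP (n + m).
     \<forall>(x, y, z) \<in> \<pi>. x \<in> {n + 1..n + 2 * m} \<and> y \<in> {n + 1..n + 2 * m} \<and> z \<in> {n + 1..n + 2 * m} \<longrightarrow>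
       (x \<le> n + m \<and> y \<le> n + m) \<or> (x \<le> n + m \<and> z \<le> n + m) \<or> (y \<le> n + m \<and> z \<le> n + m)}"

definition tri_idx :: "nat \<Rightarrow> nat \<Rightarrow> (nat \<times> nat) set" where
  "tri_idx n m = {(i, j). 1 \<le> i \<and> i \<le> j \<and> j \<le> n + m - 1}"

(* A triangular array is a function that is undefined off the index triangle, so that
   equality of functions is equality of arrays. *)
definition T_set :: "nat \<Rightarrow> nat \<Rightarrow> (nat \<times> nat \<Rightarrow> int) set" where
  "T_set n m = {b \<in> extensional (tri_idx n m).
     (\<forall>i j. (i, j) \<in> tri_idx n m \<and> (i, j + 1) \<in> tri_idx n m \<longrightarrow> b (i, j) \<ge> b (i, j + 1)) \<and>
     (\<forall>i j. (i, j) \<in> tri_idx n m \<and> (i + 1, j) \<in> tri_idx n m \<longrightarrow> b (i, j) \<ge> b (i + 1, j)) \<and>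
     (\<forall>(i, j) \<in> tri_idx n m. max (int n - int i) 0 \<le> b (i, j) \<and> b (i, j) \<le> int n)}"

definition tri_of :: "nat \<Rightarrow> nat \<Rightarrow> (nat \<times> nat \<times> nat) set \<Rightarrow> (nat \<times> nat \<Rightarrow> int)" where
  "tri_of n m \<pi> =
     (\<lambda>(i, j) \<in> tri_idx n m. int (height \<pi> (i + 1) (j + 1)) - int (n + 2 * m))"

end

(* Sort a point as x \<le> y \<le> z.  If y \<le> M, its membership is read off the heights over [M]\<^sup>2;
   otherwise its complementary point has two coordinates \<le> M.  So a totally symmetric
   self-complementary plane partition of size M is determined by its heights over [M]\<^sup>2.
   Conversely, a symmetric decreasing height table on [M]\<^sup>2 with entries \<le> 2M arises in this way as soon as its
   entries satisfy a i j \<ge> 2M + 1 - i.  This forces a 1 j = 2M, and the condition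
   defining S_set n m says exactly that also a i j \<ge> n + 2m.  Under a = b + (n + 2m) the two lower
   bounds become b i j \<ge> max (n - i) 0. *)
theory Submission
  imports Defs
begin

section \<open>Columns and heights of plane partitions\<close>

lemma down_closed_eq_atLeastAtMost_card:
  fixes A :: "nat set"
  assumes "finite A" "0 \<notin> A" and down: "\<And>x y. y \<in> A \<Longrightarrow> 1 \<le> x \<Longrightarrow> x \<le> y \<Longrightarrow> x \<in> A"
  shows "A = {1..card A}"
proof (cases "A = {}")
  case False
  have "A = {1..Max A}"
  proof (intro equalityI subsetI)
    fix x assume "x \<in> A"
    then show "x \<in> {1..Max A}"
      using assms(1,2) by (cases x) auto
  next
    fix x assume "x \<in> {1..Max A}"
    then show "x \<in> A"
      using down[OF Max_in[OF assms(1) False]] by simp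
  qed
  then show ?thesis
    by (metis card_atLeastAtMost diff_Suc_1 One_nat_def Suc_eq_plus1)
qed simp

lemma plane_partition_downD:
  assumes "plane_partition \<pi>" "(x2, y2, z2) \<in> \<pi>"
    and "1 \<le> x1" "x1 \<le> x2" "1 \<le> y1" "y1 \<le> y2" "1 \<le> z1" "z1 \<le> z2"
  shows "(x1, y1, z1) \<in> \<pi>"
  using assms unfolding plane_partition_def by blast

text \<open>The column over \<open>(x, y)\<close> is a finite down-closed set of positive integers,
  hence an initial segment. Membership thereby turns into an inequality between numbers.\<close>

lemma mem_iff_le_height:
  assumes "plane_partition \<pi>" "1 \<le> x" "1 \<le> y"
  shows "(x, y, z) \<in> \<pi> \<longleftrightarrow> 1 \<le> z \<and> z \<le> height \<pi> x y"
proof -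
  let ?A = "{z. (x, y, z) \<in> \<pi>}"
  have "finite \<pi>" and pos: "(x, y, 0) \<notin> \<pi>"
    using assms(1) by (auto simp: plane_partition_def)
  have "finite ?A"
    by (rule finite_subset[of _ "(\<lambda>(x, y, z). z) ` \<pi>"]) (use \<open>finite \<pi>\<close> in force)+
  then have "?A = {1..card ?A}"
    using pos assms by (intro down_closed_eq_atLeastAtMost_card) (auto intro: plane_partition_downD)
  then show ?thesis
    unfolding height_def by (metis (no_types, lifting) atLeastAtMost_iff mem_Collect_eq)
qed

lemma height_antimono:
  assumes "plane_partition \<pi>" "1 \<le> x1" "x1 \<le> x2" "1 \<le> y1" "y1 \<le> y2"
  shows "height \<pi> x2 y2 \<le> height \<pi> x1 y1"
proof (cases "height \<pi> x2 y2 = 0")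
  case False
  then have "(x2, y2, height \<pi> x2 y2) \<in> \<pi>"
    using assms by (simp add: mem_iff_le_height)
  then have "(x1, y1, height \<pi> x2 y2) \<in> \<pi>"
    using False assms by (auto intro: plane_partition_downD)
  then show ?thesis
    using assms by (simp add: mem_iff_le_height)
qed simp

lemma totally_symmetric_iff:
  assumes "totally_symmetric \<pi>"
  shows "(x, z, y) \<in> \<pi> \<longleftrightarrow> (x, y, z) \<in> \<pi>" "(y, x, z) \<in> \<pi> \<longleftrightarrow> (x, y, z) \<in> \<pi>"
    "(y, z, x) \<in> \<pi> \<longleftrightarrow> (x, y, z) \<in> \<pi>" "(z, x, y) \<in> \<pi> \<longleftrightarrow> (x, y, z) \<in> \<pi>"
    "(z, y, x) \<in> \<pi> \<longleftrightarrow> (x, y, z) \<in> \<pi>"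
  using assms unfolding totally_symmetric_def by blast+

section \<open>Heights of totally symmetric self-complementary plane partitions\<close>

context
  fixes M :: nat and \<pi> :: "(nat \<times> nat \<times> nat) set"
  assumes \<pi>: "\<pi> \<in> TSSCPP M"
begin

lemma TSSCPP_plane_partition: "plane_partition \<pi>"
  and TSSCPP_totally_symmetric: "totally_symmetric \<pi>"
  and TSSCPP_boxD: "(x, y, z) \<in> \<pi> \<Longrightarrow> x \<in> {1..2 * M} \<and> y \<in> {1..2 * M} \<and> z \<in> {1..2 * M}"
  and TSSCPP_complement_iff:
    "x \<in> {1..2 * M} \<Longrightarrow> y \<in> {1..2 * M} \<Longrightarrow> z \<in> {1..2 * M} \<Longrightarrow>
      (2 * M + 1 - x, 2 * M + 1 - y, 2 * M + 1 - z) \<in> \<pi> \<longleftrightarrow> (x, y, z) \<notin> \<pi>"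
  using \<pi> unfolding TSSCPP_def self_complementary_def by blast+

text \<open>Complementation exchanges \<open>i\<close> and \<open>2 * M + 1 - i\<close>, so up to a
  permutation it only replaces \<open>j\<close> by \<open>2 * M + 1 - j\<close>, which is larger as
  \<open>j \<le> M\<close>. Were the point missing, this larger point would be present and would
  force it in by downward closure.\<close>

lemma TSSCPP_antidiagonal_mem:
  assumes "1 \<le> i" "i \<le> M" "1 \<le> j" "j \<le> M"
  shows "(i, j, 2 * M + 1 - i) \<in> \<pi>"
proof (rule ccontr)
  assume "(i, j, 2 * M + 1 - i) \<notin> \<pi>"
  then have "(2 * M + 1 - i, 2 * M + 1 - j, 2 * M + 1 - (2 * M + 1 - i)) \<in> \<pi>"
    using assms by (subst TSSCPP_complement_iff) auto
  then have "(i, 2 * M + 1 - j, 2 * M + 1 - i) \<in> \<pi>"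
    using assms by (simp add: totally_symmetric_iff(5)[OF TSSCPP_totally_symmetric, of _ _ i])
  then have "(i, j, 2 * M + 1 - i) \<in> \<pi>"
    by (rule plane_partition_downD[OF TSSCPP_plane_partition]) (use assms in auto)
  with \<open>(i, j, 2 * M + 1 - i) \<notin> \<pi>\<close> show False ..
qed

lemma TSSCPP_height_le:
  assumes "1 \<le> x" "1 \<le> y"
  shows "height \<pi> x y \<le> 2 * M"
proof (cases "height \<pi> x y = 0")
  case False
  then have "(x, y, height \<pi> x y) \<in> \<pi>"
    using assms by (simp add: mem_iff_le_height[OF TSSCPP_plane_partition])
  then show ?thesis
    using TSSCPP_boxD by fastforce
qed simp

lemma TSSCPP_height_ge:
  assumes "1 \<le> i" "i \<le> M" "1 \<le> j" "j \<le> M"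
  shows "2 * M + 1 - i \<le> height \<pi> i j"
  using TSSCPP_antidiagonal_mem[OF assms] assms
  by (simp add: mem_iff_le_height[OF TSSCPP_plane_partition])

end

text \<open>Exchanging \<pi> and \<rho> turns the inclusion into equality, as injectivity requires.
  \<open>low\<close> is an equivalence because sorted points with \<open>y > M\<close> are handled
  through their complements, where non-membership has to be carried from \<pi> to \<rho>.\<close>

lemma TSSCPP_subset_if_low_mem:
  assumes \<pi>: "\<pi> \<in> TSSCPP M" and \<rho>: "\<rho> \<in> TSSCPP M"
    and low: "\<And>x y z. 1 \<le> x \<Longrightarrow> x \<le> y \<Longrightarrow> y \<le> M \<Longrightarrow> (x, y, z) \<in> \<pi> \<longleftrightarrow> (x, y, z) \<in> \<rho>"
  shows "\<pi> \<subseteq> \<rho>"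
proof -
  note sym = TSSCPP_totally_symmetric[OF \<pi>] TSSCPP_totally_symmetric[OF \<rho>]
  have sorted: "(x, y, z) \<in> \<rho>" if "(x, y, z) \<in> \<pi>" "x \<le> y" "y \<le> z" for x y z
  proof (cases "y \<le> M")
    case True
    then show ?thesis
      using that low TSSCPP_boxD[OF \<pi> that(1)] by simp
  next
    case False
    have box: "x \<in> {1..2 * M}" "y \<in> {1..2 * M}" "z \<in> {1..2 * M}"
      using TSSCPP_boxD[OF \<pi> that(1)] by auto
    have "(2 * M + 1 - x, 2 * M + 1 - y, 2 * M + 1 - z) \<notin> \<pi>"
      using that(1) box by (simp only: TSSCPP_complement_iff[OF \<pi>] not_not)
    \<comment> \<open>Complementing reverses the order. Reading the point backwards sorts it again,
      and its two smaller coordinates are now at most \<open>M\<close>, so \<open>low\<close>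
      applies.\<close>
    then have "(2 * M + 1 - z, 2 * M + 1 - y, 2 * M + 1 - x) \<notin> \<pi>"
      using sym(1) by (metis totally_symmetric_iff(5))
    then have "(2 * M + 1 - z, 2 * M + 1 - y, 2 * M + 1 - x) \<notin> \<rho>"
      using low[of "2 * M + 1 - z" "2 * M + 1 - y"] box False that by simp
    then have "(2 * M + 1 - x, 2 * M + 1 - y, 2 * M + 1 - z) \<notin> \<rho>"
      using sym(2) by (metis totally_symmetric_iff(5))
    then show ?thesis
      using box by (simp only: TSSCPP_complement_iff[OF \<rho>] not_not)
  qed
  show ?thesis
  proof (rule subrelI, clarify)
    fix x y z assume mem: "(x, y, z) \<in> \<pi>"
    consider "x \<le> y" "y \<le> z" | "x \<le> z" "z \<le> y" | "y \<le> x" "x \<le> z" | "y \<le> z" "z \<le> x"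
      | "z \<le> x" "x \<le> y" | "z \<le> y" "y \<le> x"
      by linarith
    then show "(x, y, z) \<in> \<rho>"
      by cases (use mem sorted sym in \<open>metis totally_symmetric_iff\<close>)+
  qed
qed

section \<open>The map into triangular arrays and its injectivity\<close>

lemma S_setD:
  assumes "\<pi> \<in> S_set n m"
  shows "\<pi> \<in> TSSCPP (n + m)"
    and "\<And>x y z. (x, y, z) \<in> \<pi> \<Longrightarrow> x \<in> {n + 1..n + 2 * m} \<Longrightarrow> y \<in> {n + 1..n + 2 * m} \<Longrightarrow>
      z \<in> {n + 1..n + 2 * m} \<Longrightarrow>
      (x \<le> n + m \<and> y \<le> n + m) \<or> (x \<le> n + m \<and> z \<le> n + m) \<or> (y \<le> n + m \<and> z \<le> n + m)"
  using assms unfolding S_set_def by blast+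

text \<open>The height over \<open>(n + m, n + m)\<close> is the least one on the square. The point
  \<open>(n + m, n + m, n + 2 * m)\<close> lies in \<pi> because its complement
  \<open>(n + m + 1, n + m + 1, n + 1)\<close> has two coordinates above \<open>n + m\<close> and is
  excluded by the defining condition of \<open>S_set\<close>.\<close>

lemma S_set_height_ge:
  assumes S: "\<pi> \<in> S_set n m" and ij: "1 \<le> i" "i \<le> n + m" "1 \<le> j" "j \<le> n + m"
  shows "n + 2 * m \<le> height \<pi> i j"
proof (cases "m = 0")
  case True
  \<comment> \<open>The window \<open>{n + 1..n + 2 * m}\<close> is empty here, but
    \<open>2 * n + 1 - i > n\<close> for \<open>i \<le> n\<close>.\<close>
  then show ?thesis
    using TSSCPP_height_ge[OF S_setD(1)[OF S] ij] ij by simp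
next
  case False
  note T = S_setD(1)[OF S]
  have "(n + m + 1, n + m + 1, n + 1) \<notin> \<pi>"
    using S_setD(2)[OF S, of "n + m + 1" "n + m + 1" "n + 1"] False by auto
  moreover have "2 * (n + m) + 1 - (n + m) = n + m + 1" "2 * (n + m) + 1 - (n + 2 * m) = n + 1"
    by simp_all
  ultimately have "(n + m, n + m, n + 2 * m) \<in> \<pi>"
    using TSSCPP_complement_iff[OF T, of "n + m" "n + m" "n + 2 * m"] False by (simp add: ac_simps)
  then have "n + 2 * m \<le> height \<pi> (n + m) (n + m)"
    using ij by (simp add: mem_iff_le_height[OF TSSCPP_plane_partition[OF T]])
  also have "\<dots> \<le> height \<pi> i j"
    using ij by (intro height_antimono[OF TSSCPP_plane_partition[OF T]])
  finally show ?thesis .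
qed

lemma tri_of_mem_T_set:
  assumes "\<pi> \<in> S_set n m"
  shows "tri_of n m \<pi> \<in> T_set n m"
proof -
  note T = S_setD(1)[OF assms]
  have anti: "height \<pi> x2 y2 \<le> height \<pi> x1 y1" if "1 \<le> x1" "x1 \<le> x2" "1 \<le> y1" "y1 \<le> y2" for x1 x2 y1 y2
    using that by (intro height_antimono[OF TSSCPP_plane_partition[OF T]])
  \<comment> \<open>The index shift matters: with \<open>M = n + m\<close>, the bound
    \<open>2 * M + 1 - (i + 1)\<close> becomes \<open>n - i\<close> after subtracting
    \<open>n + 2 * m\<close>, and \<open>2 * M\<close> becomes \<open>n\<close>.\<close>
  have bounds: "max (int n - int i) 0 \<le> int (height \<pi> (i + 1) (j + 1)) - int (n + 2 * m) \<and>
      int (height \<pi> (i + 1) (j + 1)) - int (n + 2 * m) \<le> int n"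
    if "(i, j) \<in> tri_idx n m" for i j
  proof -
    have ij: "1 \<le> i + 1" "i + 1 \<le> n + m" "1 \<le> j + 1" "j + 1 \<le> n + m"
      using that by (auto simp: tri_idx_def)
    show ?thesis
      using S_set_height_ge[OF assms ij] TSSCPP_height_ge[OF T ij] TSSCPP_height_le[OF T ij(1,3)]
      by auto
  qed
  show ?thesis
    using bounds anti unfolding T_set_def tri_of_def by auto
qed

lemma inj_on_tri_of: "inj_on (tri_of n m) (S_set n m)"
proof -
  have "\<pi> \<subseteq> \<rho>" if "\<pi> \<in> S_set n m" "\<rho> \<in> S_set n m" and eq: "tri_of n m \<pi> = tri_of n m \<rho>" for \<pi> \<rho>
  proof -
    note T = that(1,2)[THEN S_setD(1)]
    have "height \<pi> x y = height \<rho> x y" if xy: "1 \<le> x" "x \<le> y" "y \<le> n + m" for x y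
    \<comment> \<open>The array omits row 1. There the lower bound \<open>2 * M + 1 - 1\<close>
      meets the upper bound \<open>2 * M\<close>, where \<open>M = n + m\<close>, so the height is
      forced.\<close>
    proof (cases "x = 1")
      case True
      then show ?thesis
        using T[THEN TSSCPP_height_ge, of 1 y] T[THEN TSSCPP_height_le, of 1 y] xy by simp
    next
      case False
      then have "(x - 1, y - 1) \<in> tri_idx n m"
        using xy by (auto simp: tri_idx_def)
      then show ?thesis
        using fun_cong[OF eq, of "(x - 1, y - 1)"] xy by (simp add: tri_of_def)
    qed
    then show ?thesis
      by (intro TSSCPP_subset_if_low_mem[OF T])
        (simp add: T[THEN TSSCPP_plane_partition, THEN mem_iff_le_height])
  qed
  then show ?thesis
    by (intro inj_onI) (metis subset_antisym)
qed

section \<open>From a height table on the low square to a plane partition\<close>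

locale height_table =
  fixes M :: nat and a :: "nat \<Rightarrow> nat \<Rightarrow> nat"
  assumes a_commute: "a i j = a j i"
    and a_antimono: "1 \<le> i \<Longrightarrow> i \<le> i' \<Longrightarrow> i' \<le> M \<Longrightarrow> 1 \<le> j \<Longrightarrow> j \<le> M \<Longrightarrow> a i' j \<le> a i j"
    and a_ge: "1 \<le> i \<Longrightarrow> i \<le> M \<Longrightarrow> 1 \<le> j \<Longrightarrow> j \<le> M \<Longrightarrow> 2 * M + 1 - i \<le> a i j"
    and a_le: "1 \<le> i \<Longrightarrow> i \<le> M \<Longrightarrow> 1 \<le> j \<Longrightarrow> j \<le> M \<Longrightarrow> a i j \<le> 2 * M"
begin

abbreviation co :: "nat \<Rightarrow> nat" where
  "co x \<equiv> 2 * M + 1 - x"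

text \<open>A membership test with \<open>x\<close> and \<open>y\<close> as reference pair on one
  side of \<open>M\<close>: the first disjunct compares \<open>z\<close> with the table, the second
  negates that test at the complementary point. Any three coordinates contain such a pair.\<close>

definition below :: "nat \<Rightarrow> nat \<Rightarrow> nat \<Rightarrow> bool" where
  "below x y z \<longleftrightarrow> (x \<le> M \<and> y \<le> M \<and> z \<le> a x y) \<or> (M < x \<and> M < y \<and> a (co x) (co y) < co z)"

definition partition_of :: "(nat \<times> nat \<times> nat) set" where
  "partition_of = {(x, y, z). x \<in> {1..2 * M} \<and> y \<in> {1..2 * M} \<and> z \<in> {1..2 * M} \<and>
     (below x y z \<or> below x z y \<or> below y z x)}"

text \<open>This makes the choice of reference pair immaterial: three coordinates at most
  \<open>M\<close> pass every test in \<open>below\<close>, and three above \<open>M\<close> fail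
  every one.\<close>

lemma a_gt: "1 \<le> i \<Longrightarrow> i \<le> M \<Longrightarrow> 1 \<le> j \<Longrightarrow> j \<le> M \<Longrightarrow> M < a i j"
  using a_ge[of i j] by linarith

lemma below_commute: "below x y z \<longleftrightarrow> below y x z"
  unfolding below_def by (auto simp: a_commute)

lemma partition_of_symmetric:
  "(x, z, y) \<in> partition_of \<longleftrightarrow> (x, y, z) \<in> partition_of"
  "(y, x, z) \<in> partition_of \<longleftrightarrow> (x, y, z) \<in> partition_of"
  unfolding partition_of_def by (auto simp: below_commute)

lemma partition_of_totally_symmetric: "totally_symmetric partition_of"
  unfolding totally_symmetric_def using partition_of_symmetric by blast

text \<open>Another reference pair is available only if \<open>z \<le> M\<close>, and then
  \<open>a_gt\<close> gives \<open>z \<le> a x y\<close> anyway.\<close>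

lemma mem_partition_of_low:
  assumes "x \<in> {1..M}" "y \<in> {1..M}" "z \<in> {1..2 * M}"
  shows "(x, y, z) \<in> partition_of \<longleftrightarrow> z \<le> a x y"
  using assms a_gt[of x y] by (auto simp: partition_of_def below_def)

lemma mem_partition_of_high:
  assumes "x \<in> {M<..2 * M}" "y \<in> {M<..2 * M}" "z \<in> {1..2 * M}"
  shows "(x, y, z) \<in> partition_of \<longleftrightarrow> a (co x) (co y) < co z"
proof -
  \<comment> \<open>Another reference pair needs \<open>z > M\<close> as well. Its test then fails,
    since the table value exceeds \<open>M\<close> while \<open>co v \<le> M\<close>.\<close>
  have False if "w \<in> {M<..2 * M}" "z \<in> {M<..2 * M}" "v \<in> {M<..2 * M}" "a (co w) (co z) < co v" for v w
  proof -
    have "M < a (co w) (co z)"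
      using that by (intro a_gt) auto
    then show False
      using that by auto
  qed
  then show ?thesis
    using assms by (auto simp: partition_of_def below_def)
qed

text \<open>Two of the three coordinates lie on the same side of \<open>M\<close>. With these as
  reference pair, \<open>co\<close> moves them to the other side, where the test is the negation of
  the original one.\<close>

lemma partition_of_complement:
  assumes "x \<in> {1..2 * M}" "y \<in> {1..2 * M}" "z \<in> {1..2 * M}"
  shows "(x, y, z) \<in> partition_of \<longleftrightarrow> (co x, co y, co z) \<notin> partition_of"
proof -
  have *: "(x, y, z) \<in> partition_of \<longleftrightarrow> (co x, co y, co z) \<notin> partition_of"
    if "x \<in> {1..2 * M}" "y \<in> {1..2 * M}" "z \<in> {1..2 * M}" "x \<le> M \<longleftrightarrow> y \<le> M" for x y z
  proof (cases "x \<le> M")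
    case True
    have "(x, y, z) \<in> partition_of \<longleftrightarrow> z \<le> a x y"
      using that True by (intro mem_partition_of_low) auto
    moreover have "(co x, co y, co z) \<in> partition_of \<longleftrightarrow> a (co (co x)) (co (co y)) < co (co z)"
      using that True by (intro mem_partition_of_high) auto
    ultimately show ?thesis
      using that by auto
  next
    case False
    have "(x, y, z) \<in> partition_of \<longleftrightarrow> a (co x) (co y) < co z"
      using that False by (intro mem_partition_of_high) auto
    moreover have "(co x, co y, co z) \<in> partition_of \<longleftrightarrow> co z \<le> a (co x) (co y)"
      using that False by (intro mem_partition_of_low) auto
    ultimately show ?thesis
      by auto
  qed
  consider "x \<le> M \<longleftrightarrow> y \<le> M" | "x \<le> M \<longleftrightarrow> z \<le> M" | "y \<le> M \<longleftrightarrow> z \<le> M"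
    by blast
  then show ?thesis
    by cases (use assms *[of x y z] *[of x z y] *[of y z x] partition_of_symmetric in metis)+
qed

text \<open>If \<open>x\<close> and \<open>y\<close> lie on the same side of \<open>M\<close>, their
  test is visibly monotone in the last coordinate. Otherwise that coordinate is paired with
  whichever of the two shares its side, and the table is decreasing as long as \<open>z\<close> and
  \<open>z'\<close> do not lie on different sides.\<close>

lemma partition_of_down_last:
  assumes mem: "(x, y, z) \<in> partition_of" and z': "1 \<le> z'" "z' \<le> z"
  shows "(x, y, z') \<in> partition_of"
proof -
  have box: "x \<in> {1..2 * M}" "y \<in> {1..2 * M}" "z \<in> {1..2 * M}"
    using mem by (auto simp: partition_of_def)
  have mixed: "(x, y, z') \<in> partition_of"
    if mem: "(x, y, z) \<in> partition_of" and "x \<in> {1..M}" "y \<in> {M<..2 * M}" for x y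
  proof -
    have mem': "(x, z, y) \<in> partition_of" "(y, z, x) \<in> partition_of"
      using mem partition_of_symmetric by metis+
    consider "z \<le> M" | "M < z" "M < z'" | "M < z" "z' \<le> M"
      by linarith
    then have "(x, z', y) \<in> partition_of"
    proof cases
      case 1
      have "y \<le> a x z"
        using mem' 1 that box by (subst (asm) mem_partition_of_low) auto
      also have "a x z \<le> a x z'"
        using a_antimono[of z' z x] 1 z' that(2) by (simp add: a_commute)
      finally show ?thesis
        using 1 z' that by (subst mem_partition_of_low) auto
    next
      case 2
      have "a (co z') (co y) \<le> a (co z) (co y)"
        using 2 z' that box by (intro a_antimono) auto
      also have "\<dots> < co x"
        using mem'(2) 2 that box by (subst (asm) mem_partition_of_high) (auto simp: a_commute)
      finally have "(y, z', x) \<in> partition_of"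
        using 2 z' that box by (subst mem_partition_of_high) (auto simp: a_commute)
      then show ?thesis
        using partition_of_symmetric by metis
    next
      case 3
      \<comment> \<open>Passing from \<open>z > M\<close> to \<open>z' \<le> M\<close> changes the
        partner from \<open>y\<close> to \<open>x\<close>. The bound \<open>a_ge\<close> bridges the
        two tests: it gives \<open>y\<close> at \<open>co y\<close> and \<open>co x\<close> at
        \<open>x\<close>, and the membership of the original point supplies the inequality in
        between.\<close>
      have "y \<le> a (co y) (co z)"
        using a_ge[of "co y" "co z"] 3 that box by auto
      also have "\<dots> < co x"
        using mem'(2) 3 that box by (subst (asm) mem_partition_of_high) auto
      also have "co x \<le> a x z'"
        using a_ge[of x z'] 3 that z' by auto
      finally show ?thesis
        using 3 z' that by (subst mem_partition_of_low) auto
    qed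
    then show ?thesis
      using partition_of_symmetric by metis
  qed
  consider "x \<le> M" "y \<le> M" | "M < x" "M < y" | "x \<le> M" "M < y" | "M < x" "y \<le> M"
    by linarith
  then show ?thesis
  proof cases
    case 1
    then show ?thesis
      using mem box z' mem_partition_of_low[of x y z] mem_partition_of_low[of x y z'] by simp
  next
    case 2
    then show ?thesis
      using mem box z' mem_partition_of_high[of x y z] mem_partition_of_high[of x y z'] by auto
  next
    case 3
    then show ?thesis
      using mixed mem box by simp
  next
    case 4
    then have "(y, x, z') \<in> partition_of"
      using mixed[of y x] mem box partition_of_symmetric(2)[of y x z] by simp
    then show ?thesis
      using partition_of_symmetric(2) by metis
  qed
qed

text \<open>For downward closure the coordinates are lowered one at a time, each after being moved
  to the last place by symmetry.\<close>

lemma partition_of_plane_partition: "plane_partition partition_of"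
  unfolding plane_partition_def
proof (intro conjI allI impI)
  show "finite partition_of"
    by (rule finite_subset[of _ "{1..2 * M} \<times> {1..2 * M} \<times> {1..2 * M}"]) (auto simp: partition_of_def)
  show "\<forall>(x, y, z) \<in> partition_of. 1 \<le> x \<and> 1 \<le> y \<and> 1 \<le> z"
    by (auto simp: partition_of_def)
next
  fix x1 y1 z1 x2 y2 z2
  assume *: "(x2, y2, z2) \<in> partition_of \<and> 1 \<le> x1 \<and> x1 \<le> x2 \<and> 1 \<le> y1 \<and> y1 \<le> y2 \<and> 1 \<le> z1 \<and> z1 \<le> z2"
  then have "(x2, y2, z1) \<in> partition_of"
    using partition_of_down_last by blast
  then have "(x2, z1, y2) \<in> partition_of"
    using partition_of_symmetric by metis
  then have "(x2, z1, y1) \<in> partition_of"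
    using partition_of_down_last * by blast
  then have "(z1, y1, x2) \<in> partition_of"
    using partition_of_symmetric by metis
  then have "(z1, y1, x1) \<in> partition_of"
    using partition_of_down_last * by blast
  then show "(x1, y1, z1) \<in> partition_of"
    using partition_of_symmetric by metis
qed

lemma partition_of_TSSCPP: "partition_of \<in> TSSCPP M"
  unfolding TSSCPP_def self_complementary_def
  using partition_of_plane_partition partition_of_totally_symmetric partition_of_complement
  by (auto simp: partition_of_def)

lemma height_partition_of:
  assumes "x \<in> {1..M}" "y \<in> {1..M}"
  shows "height partition_of x y = a x y"
proof -
  have "{z. (x, y, z) \<in> partition_of} = {1..a x y}"
  proof (intro equalityI subsetI)
    fix z assume "z \<in> {z. (x, y, z) \<in> partition_of}"
    moreover from this have "z \<in> {1..2 * M}"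
      by (auto simp: partition_of_def)
    ultimately show "z \<in> {1..a x y}"
      using mem_partition_of_low[of x y z] assms by simp
  next
    fix z assume "z \<in> {1..a x y}"
    then show "z \<in> {z. (x, y, z) \<in> partition_of}"
      using mem_partition_of_low[of x y z] a_le[of x y] assms by simp
  qed
  then show ?thesis
    by (simp add: height_def)
qed

text \<open>Two coordinates above \<open>M\<close> together with \<open>z \<ge> n + 1\<close> would
  require a table value below \<open>co z \<le> n + 2 * m\<close>, against
  \<open>ge\<close>.\<close>

lemma partition_of_S_set:
  assumes M: "M = n + m" and ge: "\<And>i j. i \<in> {1..M} \<Longrightarrow> j \<in> {1..M} \<Longrightarrow> n + 2 * m \<le> a i j"
  shows "partition_of \<in> S_set n m"
proof -
  have high: False
    if "(x, y, z) \<in> partition_of" "M < x" "M < y" "n + 1 \<le> z" for x y z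
  proof -
    have box: "x \<in> {M<..2 * M}" "y \<in> {M<..2 * M}" "z \<in> {1..2 * M}"
      using that by (auto simp: partition_of_def)
    then have "a (co x) (co y) < co z"
      using that(1) mem_partition_of_high by blast
    moreover have "n + 2 * m \<le> a (co x) (co y)"
      using box by (intro ge) auto
    ultimately show False
      using that(4) M by simp
  qed
  have "x \<le> M \<and> y \<le> M \<or> x \<le> M \<and> z \<le> M \<or> y \<le> M \<and> z \<le> M"
    if mem: "(x, y, z) \<in> partition_of" and "n + 1 \<le> x" "n + 1 \<le> y" "n + 1 \<le> z" for x y z
  proof -
    have "(x, z, y) \<in> partition_of" "(y, z, x) \<in> partition_of"
      using mem partition_of_symmetric by metis+
    then show ?thesis
      using high mem that(2-4) by (meson not_le)
  qed
  then show ?thesis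
    using partition_of_TSSCPP M unfolding S_set_def by auto
qed

end

section \<open>Completing a triangular array to a symmetric height table\<close>

definition table_of :: "nat \<Rightarrow> nat \<Rightarrow> (nat \<times> nat \<Rightarrow> int) \<Rightarrow> nat \<Rightarrow> nat \<Rightarrow> nat" where
  "table_of n m b i j =
     (if min i j \<le> 1 then 2 * (n + m) else nat (b (min i j - 1, max i j - 1)) + (n + 2 * m))"

lemma table_of_bounds:
  assumes b: "b \<in> T_set n m" and ij: "i \<in> {1..n + m}" "j \<in> {1..n + m}"
  shows "2 * (n + m) + 1 - i \<le> table_of n m b i j"
    and "n + 2 * m \<le> table_of n m b i j"
    and "table_of n m b i j \<le> 2 * (n + m)"
proof -
  have bounds: "max (int n - int k) 0 \<le> b (k, l) \<and> b (k, l) \<le> int n" if "(k, l) \<in> tri_idx n m" for k l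
    using b that unfolding T_set_def by fast
  have "2 * (n + m) + 1 - i \<le> table_of n m b i j \<and> n + 2 * m \<le> table_of n m b i j \<and>
      table_of n m b i j \<le> 2 * (n + m)"
  proof (cases "min i j \<le> 1")
    case True
    \<comment> \<open>The value \<open>2 * (n + m)\<close> filled in for row and column 1 is the
      only one that the bounds allow at \<open>i = 1\<close>; symmetry extends it to
      \<open>j = 1\<close>.\<close>
    then show ?thesis
      using ij by (auto simp: table_of_def)
  next
    case False
    define k l where kl: "k = min i j - 1" "l = max i j - 1"
    have "(k, l) \<in> tri_idx n m"
      using ij False by (auto simp: tri_idx_def kl)
    from bounds[OF this]
    have "int n - int k \<le> b (k, l)" "b (k, l) \<le> int n"
      by simp_all
    moreover have "table_of n m b i j = nat (b (k, l)) + (n + 2 * m)"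
      using False by (simp add: table_of_def kl)
    \<comment> \<open>The array bound involves the smaller index, so
      \<open>n - k \<ge> n - (i - 1)\<close> also when the minimum is \<open>j\<close>.\<close>
    moreover have "k \<le> i - 1" "1 \<le> i"
      using ij by (auto simp: kl)
    ultimately show ?thesis
      by auto
  qed
  then show "2 * (n + m) + 1 - i \<le> table_of n m b i j" "n + 2 * m \<le> table_of n m b i j"
    "table_of n m b i j \<le> 2 * (n + m)"
    by blast+
qed

text \<open>Increasing \<open>i\<close> moves down a column of the triangle if \<open>i < j\<close>
  and along a row if \<open>j \<le> i\<close>, so each monotonicity condition of
  \<open>T_set\<close> covers one case. For \<open>min i j \<le> 1\<close> the right side is the
  maximal value.\<close>

lemma table_of_Suc_le:
  assumes b: "b \<in> T_set n m" and ij: "i \<in> {1..<n + m}" "j \<in> {1..n + m}"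
  shows "table_of n m b (Suc i) j \<le> table_of n m b i j"
proof (cases "min i j \<le> 1")
  case True
  then show ?thesis
    using table_of_bounds(3)[OF b, of "Suc i" j] ij by (auto simp: table_of_def)
next
  case False
  show ?thesis
  proof (cases "i < j")
    case True
    have idx: "(i - 1, j - 1) \<in> tri_idx n m" "(i - 1 + 1, j - 1) \<in> tri_idx n m"
      using ij False True by (auto simp: tri_idx_def)
    have "b (i - 1 + 1, j - 1) \<le> b (i - 1, j - 1)"
      using b idx unfolding T_set_def by blast
    then show ?thesis
      using ij False True by (simp add: table_of_def min_def max_def nat_mono)
  next
    case ge: False
    have idx: "(j - 1, i - 1) \<in> tri_idx n m" "(j - 1, i - 1 + 1) \<in> tri_idx n m"
      using ij False ge by (auto simp: tri_idx_def)
    have "b (j - 1, i - 1 + 1) \<le> b (j - 1, i - 1)"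
      using b idx unfolding T_set_def by blast
    then show ?thesis
      using ij False ge by (auto simp: table_of_def min_def max_def nat_mono)
  qed
qed

lemma height_table_table_of:
  assumes b: "b \<in> T_set n m"
  shows "height_table (n + m) (table_of n m b)"
proof
  show "table_of n m b i j = table_of n m b j i" for i j
    by (simp add: table_of_def min.commute max.commute)
  show "table_of n m b i' j \<le> table_of n m b i j"
    if "1 \<le> i" "i \<le> i'" "i' \<le> n + m" "1 \<le> j" "j \<le> n + m" for i i' j
    using that(2,3)
  proof (induction i' rule: dec_induct)
    case (step k)
    then show ?case
      using table_of_Suc_le[OF b, of k j] that by simp
  qed simp
qed (use table_of_bounds[OF b] in auto)

section \<open>Surjectivity and the bijection\<close>

lemma T_set_subset_image_tri_of: "T_set n m \<subseteq> tri_of n m ` S_set n m"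
proof
  fix b assume b: "b \<in> T_set n m"
  interpret height_table "n + m" "table_of n m b"
    using b by (rule height_table_table_of)
  have "partition_of \<in> S_set n m"
    using table_of_bounds(2)[OF b] by (intro partition_of_S_set) auto
  moreover have "tri_of n m partition_of = b"
  proof (rule extensionalityI)
    show "tri_of n m partition_of \<in> extensional (tri_idx n m)"
      by (simp add: tri_of_def)
    show "b \<in> extensional (tri_idx n m)"
      using b by (simp add: T_set_def)
    fix p assume p: "p \<in> tri_idx n m"
    obtain i j where ij: "p = (i, j)"
      by fastforce
    \<comment> \<open>Nonnegativity ensures that the conversion by \<open>nat\<close> in
      \<open>table_of\<close> loses nothing, so subtracting \<open>n + 2 * m\<close> recovers
      \<open>b\<close>.\<close>
    have "0 \<le> b (i, j)"
      using b p ij unfolding T_set_def by fastforce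
    then show "tri_of n m partition_of p = b p"
      using p ij by (auto simp: tri_of_def tri_idx_def height_partition_of table_of_def)
  qed
  ultimately show "b \<in> tri_of n m ` S_set n m"
    by (metis imageI)
qed

theorem theorem3p4:
  fixes n m :: nat
  assumes "n \<ge> 1"
  shows "(\<forall>\<pi> \<in> S_set n m. tri_of n m \<pi> \<in> T_set n m) \<and>
         bij_betw (tri_of n m) (S_set n m) (T_set n m)"
  unfolding bij_betw_def
  using tri_of_mem_T_set inj_on_tri_of T_set_subset_image_tri_of by blast

end
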